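(* Let $\mathbf{P}=(\mathbf{P}^i)_{i\in\mathfrak{N}}\in\boldsymbol{\mathcal{S}}^\star$ be an admissible price coordination process and let $\mathbf{R}=(\mathbf{R}^i)_{i\in\mathfrak{N}}\in-\boldsymbol{\mathcal{S}}$ be an admissible resource coordination process. Then, for all $t\in\{0,\dots,T\}$ and all $x_t=(x_t^i)_{i\in\mathfrak{N}}\in\mathbb{X}_t$, $$\sum_{i\in\mathfrak{N}}\underline{V}_t^i[\mathbf{P}^i](x_t^i)\;\le\;V_t(x_t)\;\le\;\sum_{i\in\mathfrak{N}}\overline{V}_t^i[\mathbf{R}^i](x_t^i).$$
   Context: Data. $\mathfrak{N}$ is a finite set of units, $T\ge 1$ an integer. For each $i\in\mathfrak{N}$ there are measurable spaces $\mathbb{X}_t^i$ ($0\le t\le T$), $\mathbb{U}_t^i$ ($0\le t\le T-1$), $\mathbb{W}_t^i$ ($1\le t\le T$), and measurable vector spaces $\mathcal{R}_t^i$ (resources), $\mathcal{P}_t^i$ (prices), $0\le t\le T-1$, paired by a bilinear form $\langle\cdot,\cdot\rangle:\mathcal{P}_t^i\times\mathcal{R}_t^i\to\mathbb{R}$. For $0\le t\le T-1$ there are measurable maps $g_t^i:\mathbb{X}_t^i\times\mathbb{U}_t^i\times\mathbb{W}_{t+1}^i\to\mathbb{X}_{t+1}^i$ (dynamics), $\Theta_t^i:\mathbb{X}_t^i\times\mathbb{U}_t^i\to\mathcal{R}_t^i$ (coupling functions), $L_t^i:\mathbb{X}_t^i\times\mathbb{U}_t^i\times\mathbb{W}_{t+1}^i\to(-\infty,+\infty]$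 (costs), and a measurable final cost $K^i:\mathbb{X}_T^i\to(-\infty,+\infty]$. Set $\mathbb{X}_t=\prod_i\mathbb{X}_t^i$, $\mathcal{R}_t=\prod_i\mathcal{R}_t^i$, $\mathcal{P}_t=\prod_i\mathcal{P}_t^i$ (paired by $\langle p,r\rangle=\sum_i\langle p^i,r^i\rangle$), $\mathcal{R}^i=\prod_{t=0}^{T-1}\mathcal{R}_t^i$, $\mathcal{P}^i=\prod_{t=0}^{T-1}\mathcal{P}_t^i$, $\mathcal{R}=\prod_t\mathcal{R}_t$, $\mathcal{P}=\prod_t\mathcal{P}_t$. A subset $S_t\subset\mathcal{R}_t$ is given for each $0\le t\le T-1$. Noise and information. On a probability space $(\Omega,\mathcal{A},\mathbb{P})$ there are random variables $\mathbf{W}_t^i:\Omega\to\mathbb{W}_t^i$, $1\le t\le T$; $\mathbf{W}_t=(\mathbf{W}_t^i)_i$. Put $\mathcal{F}_t=\sigma(\mathbf{W}_1,\dots,\mathbf{W}_t)$ and $\mathcal{F}_t^i=\sigma(\mathbf{W}_1^i,\dots,\mathbf{W}_t^i)$, with $\mathcal{F}_0=\mathcal{F}_0^i=\{\emptyset,\Omega\}$. The information structure is either centralized, $\mathcal{G}_t^i=\mathcal{F}_t$ for all $i,t$, or decentralized, $\mathcal{G}_t^i=\mathcal{F}_t^i$ for all $i,t$; it is the same choice in all the problems below. Process spaces. $\widetilde{\mathbb{L}}(\mathcal{R})$ and $\widetilde{\mathbb{L}}^\star(\mathcal{P})$ are vector spaces of $(\mathcal{F}_t)$-adapted processes $(\mathbf{Y}_0,\dots,\mathbf{Y}_{T-1})$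 with values in $\mathcal{R}$, respectively $\mathcal{P}$ (products over units and over times of spaces of random variables), such that the coupling processes $\Theta_t^i(\mathbf{X}_t^i,\mathbf{U}_t^i)$ of the problems below belong to the former and the expectations of the duality products $\langle\cdot,\cdot\rangle$ are well defined (for example, square-integrable $\mathcal{F}_t$-measurable random variables with values in $\mathbb{R}^d$). Admissible sets. $\boldsymbol{\mathcal{S}}=\{\mathbf{Y}\in\widetilde{\mathbb{L}}(\mathcal{R}):\ \mathbf{Y}_t\in S_t\ \ \mathbb{P}\text{-a.s.},\ \forall t\in\{0,\dots,T-1\}\}$ and $\boldsymbol{\mathcal{S}}^\star=\{\mathbf{Z}\in\widetilde{\mathbb{L}}^\star(\mathcal{P}):\ \mathbb{E}[\langle\mathbf{Z}_t,\mathbf{Y}_t\rangle]\ge0,\ \forall\,\mathbf{Y}\in\boldsymbol{\mathcal{S}},\ \forall t\in\{0,\dots,T-1\}\}$. An admissible price (resp. resource) coordination process is an element of $\boldsymbol{\mathcal{S}}^\star$ (resp. of $-\boldsymbol{\mathcal{S}}$). Value functions, for $t\in\{0,\dots,T\}$ (equal to $\sum_iK^i$, $K^i$, $K^i$ respectively at $t=T$). For processes $(\mathbf{X}_s^i)_{t\le s\le T}$, $(\mathbf{U}_s^i)_{t\le s\le T-1}$, consider, for $s=t,\dots,T-1$: (D) $\mathbf{X}_t^i=x_t^i$ and $\mathbf{X}_{s+1}^i=g_s^i(\mathbf{X}_s^i,\mathbf{U}_s^i,\mathbf{W}_{s+1}^i)$; (M) $\sigma(\mathbf{U}_s^i)\subset\mathcal{G}_s^i$.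 Global value function: $V_t((x_t^i)_i)=\inf\mathbb{E}\big[\sum_{i}\sum_{s=t}^{T-1}L_s^i(\mathbf{X}_s^i,\mathbf{U}_s^i,\mathbf{W}_{s+1}^i)+\sum_iK^i(\mathbf{X}_T^i)\big]$ over all $(\mathbf{X},\mathbf{U})$ satisfying (D) and (M) for all $i$ and the coupling constraint $(\Theta_s^i(\mathbf{X}_s^i,\mathbf{U}_s^i))_{i}\in-S_s$ $\mathbb{P}$-a.s. for all $s\in\{t,\dots,T-1\}$. Local price value function: $\underline{V}_t^i[\mathbf{P}^i](x_t^i)=\inf\mathbb{E}\big[\sum_{s=t}^{T-1}\big(L_s^i(\mathbf{X}_s^i,\mathbf{U}_s^i,\mathbf{W}_{s+1}^i)+\langle\mathbf{P}_s^i,\Theta_s^i(\mathbf{X}_s^i,\mathbf{U}_s^i)\rangle\big)+K^i(\mathbf{X}_T^i)\big]$ over $(\mathbf{X}^i,\mathbf{U}^i)$ satisfying (D), (M). Local resource value function: $\overline{V}_t^i[\mathbf{R}^i](x_t^i)=\inf\mathbb{E}\big[\sum_{s=t}^{T-1}L_s^i(\mathbf{X}_s^i,\mathbf{U}_s^i,\mathbf{W}_{s+1}^i)+K^i(\mathbf{X}_T^i)\big]$ over $(\mathbf{X}^i,\mathbf{U}^i)$ satisfying (D), (M) and $\Theta_s^i(\mathbf{X}_s^i,\mathbf{U}_s^i)=\mathbf{R}_s^i$ ($\mathbb{P}$-a.s.) for all $s\in\{t,\dots,T-1\}$. Standing assumptions: measurability and integrability hold so that all expectations are well defined; $\underline{V}_t^i[\mathbf{P}^i](x_t^i)<+\infty$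 and $\overline{V}_t^i[\mathbf{R}^i](x_t^i)>-\infty$ for all $i,t,x_t^i$. An infimum over the empty set is $+\infty$. *)

theory Defs
  imports "HOL-Probability.Probability"
begin

definition ext_expectation :: "'a measure \<Rightarrow> ('a \<Rightarrow> ereal) \<Rightarrow> ereal" where
  "ext_expectation M f =
     enn2ereal (\<integral>\<^sup>+ \<omega>. e2ennreal (f \<omega>) \<partial>M) - enn2ereal (\<integral>\<^sup>+ \<omega>. e2ennreal (- f \<omega>) \<partial>M)"
  \<comment> \<open>\<^const>\<open>e2ennreal\<close> truncates negative values to \<open>0\<close>,
      so the two integrals are those of the positive and of the negative part\<close>

definition expectation_well_defined :: "'a measure \<Rightarrow> ('a \<Rightarrow> ereal) \<Rightarrow> bool" where
  "expectation_well_defined M f \<longleftrightarrow>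
     f \<in> borel_measurable M \<and>
     ((\<integral>\<^sup>+ \<omega>. e2ennreal (f \<omega>) \<partial>M) < \<infinity> \<or> (\<integral>\<^sup>+ \<omega>. e2ennreal (- f \<omega>) \<partial>M) < \<infinity>)"

definition measurable_vector_space :: "'v::real_vector measure \<Rightarrow> bool" where
  "measurable_vector_space V \<longleftrightarrow>
     subspace (space V) \<and>
     (\<lambda>(u, v). u + v) \<in> V \<Otimes>\<^sub>M V \<rightarrow>\<^sub>M V \<and>
     (\<lambda>(c, v). c *\<^sub>R v) \<in> (borel :: real measure) \<Otimes>\<^sub>M V \<rightarrow>\<^sub>M V"

definition bilinear_form_on ::
    "'p::real_vector set \<Rightarrow> 'r::real_vector set \<Rightarrow> ('p \<Rightarrow> 'r \<Rightarrow> real) \<Rightarrow> bool" where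
  "bilinear_form_on A B b \<longleftrightarrow>
     (\<forall>p\<in>A. \<forall>q\<in>A. \<forall>r\<in>B. b (p + q) r = b p r + b q r) \<and>
     (\<forall>p\<in>A. \<forall>r\<in>B. \<forall>s\<in>B. b p (r + s) = b p r + b p s) \<and>
     (\<forall>c. \<forall>p\<in>A. \<forall>r\<in>B. b (c *\<^sub>R p) r = c * b p r \<and> b p (c *\<^sub>R r) = c * b p r)"

definition rv_vector_space :: "'a measure \<Rightarrow> 'v::real_vector measure \<Rightarrow> ('a \<Rightarrow> 'v) set \<Rightarrow> bool" where
  "rv_vector_space F V \<L> \<longleftrightarrow>
     \<L> \<subseteq> F \<rightarrow>\<^sub>M V \<and>
     (\<lambda>\<omega>. 0) \<in> \<L> \<and>
     (\<forall>Y\<in>\<L>. \<forall>Z\<in>\<L>. (\<lambda>\<omega>. Y \<omega> + Z \<omega>) \<in> \<L>) \<and>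
     (\<forall>c. \<forall>Y\<in>\<L>. (\<lambda>\<omega>. c *\<^sub>R Y \<omega>) \<in> \<L>)"

datatype information = Centralized | Decentralized

text \<open>
  Families of measurable spaces indexed by a time \<open>t\<close> and a unit \<open>i\<close> are families of measures on one
  common type; only their carriers and sigma-algebras matter, so that the spaces may still differ
  from one index to the other.  Similarly the resource and price spaces are subspaces of common
  vector spaces.  \<open>resource_rvs D t i\<close> and \<open>price_rvs D t i\<close> are the factors of the process
  spaces, which are products over times and units.
\<close>

record ('a, 'i, 'x, 'u, 'w, 'r, 'p) multi_unit =
  units :: "'i set"
  horizon :: nat
  state_space :: "nat \<Rightarrow> 'i \<Rightarrow> 'x measure"
  control_space :: "nat \<Rightarrow> 'i \<Rightarrow> 'u measure"
  noise_space :: "nat \<Rightarrow> 'i \<Rightarrow> 'w measure"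
  resource_space :: "nat \<Rightarrow> 'i \<Rightarrow> 'r measure"
  price_space :: "nat \<Rightarrow> 'i \<Rightarrow> 'p measure"
  pairing :: "nat \<Rightarrow> 'i \<Rightarrow> 'p \<Rightarrow> 'r \<Rightarrow> real"
  dynamics :: "nat \<Rightarrow> 'i \<Rightarrow> 'x \<Rightarrow> 'u \<Rightarrow> 'w \<Rightarrow> 'x"
  coupling :: "nat \<Rightarrow> 'i \<Rightarrow> 'x \<Rightarrow> 'u \<Rightarrow> 'r"
  stage_cost :: "nat \<Rightarrow> 'i \<Rightarrow> 'x \<Rightarrow> 'u \<Rightarrow> 'w \<Rightarrow> ereal"
  final_cost :: "'i \<Rightarrow> 'x \<Rightarrow> ereal"
  coupling_set :: "nat \<Rightarrow> ('i \<Rightarrow> 'r) set"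
  prob :: "'a measure"
  noise :: "nat \<Rightarrow> 'i \<Rightarrow> 'a \<Rightarrow> 'w"
  info :: information
  resource_rvs :: "nat \<Rightarrow> 'i \<Rightarrow> ('a \<Rightarrow> 'r) set"
  price_rvs :: "nat \<Rightarrow> 'i \<Rightarrow> ('a \<Rightarrow> 'p) set"

definition noise_algebra ::
    "('a, 'i, 'x, 'u, 'w, 'r, 'p) multi_unit \<Rightarrow> 'i set \<Rightarrow> nat \<Rightarrow> 'a measure" where
  "noise_algebra D J t =
     sigma (space (prob D))
       (\<Union>s\<in>{1..t}. \<Union>i\<in>J. {noise D s i -` A \<inter> space (prob D) | A. A \<in> sets (noise_space D s i)})"

definition global_algebra ::
    "('a, 'i, 'x, 'u, 'w, 'r, 'p) multi_unit \<Rightarrow> nat \<Rightarrow> 'a measure" where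
  "global_algebra D t = noise_algebra D (units D) t"

definition local_algebra ::
    "('a, 'i, 'x, 'u, 'w, 'r, 'p) multi_unit \<Rightarrow> nat \<Rightarrow> 'i \<Rightarrow> 'a measure" where
  "local_algebra D t i = noise_algebra D {i} t"

definition info_algebra ::
    "('a, 'i, 'x, 'u, 'w, 'r, 'p) multi_unit \<Rightarrow> nat \<Rightarrow> 'i \<Rightarrow> 'a measure" where
  "info_algebra D t i =
     (case info D of Centralized \<Rightarrow> global_algebra D t | Decentralized \<Rightarrow> local_algebra D t i)"

definition resource_processes ::
    "('a, 'i, 'x, 'u, 'w, 'r, 'p) multi_unit \<Rightarrow> ('i \<Rightarrow> nat \<Rightarrow> 'a \<Rightarrow> 'r) set" where
  "resource_processes D = {Y. \<forall>i\<in>units D. \<forall>t<horizon D. Y i t \<in> resource_rvs D t i}"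

definition price_processes ::
    "('a, 'i, 'x, 'u, 'w, 'r, 'p) multi_unit \<Rightarrow> ('i \<Rightarrow> nat \<Rightarrow> 'a \<Rightarrow> 'p) set" where
  "price_processes D = {Z. \<forall>i\<in>units D. \<forall>t<horizon D. Z i t \<in> price_rvs D t i}"

definition duality_product ::
    "('a, 'i, 'x, 'u, 'w, 'r, 'p) multi_unit \<Rightarrow> ('i \<Rightarrow> nat \<Rightarrow> 'a \<Rightarrow> 'p) \<Rightarrow> ('i \<Rightarrow> nat \<Rightarrow> 'a \<Rightarrow> 'r)
      \<Rightarrow> nat \<Rightarrow> 'a \<Rightarrow> real" where
  "duality_product D Z Y t \<omega> = (\<Sum>i\<in>units D. pairing D t i (Z i t \<omega>) (Y i t \<omega>))"

definition admissible_set ::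
    "('a, 'i, 'x, 'u, 'w, 'r, 'p) multi_unit \<Rightarrow> ('i \<Rightarrow> nat \<Rightarrow> 'a \<Rightarrow> 'r) set" where
  "admissible_set D =
     {Y \<in> resource_processes D.
        \<forall>t<horizon D. AE \<omega> in prob D. (\<lambda>i\<in>units D. Y i t \<omega>) \<in> coupling_set D t}"

definition admissible_prices ::
    "('a, 'i, 'x, 'u, 'w, 'r, 'p) multi_unit \<Rightarrow> ('i \<Rightarrow> nat \<Rightarrow> 'a \<Rightarrow> 'p) set" where
  "admissible_prices D =
     {Z \<in> price_processes D.
        \<forall>Y\<in>admissible_set D. \<forall>t<horizon D.
          ext_expectation (prob D) (\<lambda>\<omega>. ereal (duality_product D Z Y t \<omega>)) \<ge> 0}"

definition admissible_resources ::
    "('a, 'i, 'x, 'u, 'w, 'r::real_vector, 'p) multi_unit \<Rightarrow> ('i \<Rightarrow> nat \<Rightarrow> 'a \<Rightarrow> 'r) set" where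
  "admissible_resources D = {R. (\<lambda>i t \<omega>. - R i t \<omega>) \<in> admissible_set D}"

definition local_feasible ::
    "('a, 'i, 'x, 'u, 'w, 'r, 'p) multi_unit \<Rightarrow> 'i \<Rightarrow> nat \<Rightarrow> 'x
      \<Rightarrow> (nat \<Rightarrow> 'a \<Rightarrow> 'x) \<Rightarrow> (nat \<Rightarrow> 'a \<Rightarrow> 'u) \<Rightarrow> bool" where
  "local_feasible D i t x X U \<longleftrightarrow>
     (\<forall>\<omega>\<in>space (prob D). X t \<omega> = x) \<and>
     (\<forall>s\<in>{t..<horizon D}. \<forall>\<omega>\<in>space (prob D).
        X (Suc s) \<omega> = dynamics D s i (X s \<omega>) (U s \<omega>) (noise D (Suc s) i \<omega>)) \<and>
     (\<forall>s\<in>{t..<horizon D}. U s \<in> info_algebra D s i \<rightarrow>\<^sub>M control_space D s i)"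

definition resource_feasible ::
    "('a, 'i, 'x, 'u, 'w, 'r, 'p) multi_unit \<Rightarrow> 'i \<Rightarrow> (nat \<Rightarrow> 'a \<Rightarrow> 'r) \<Rightarrow> nat \<Rightarrow> 'x
      \<Rightarrow> (nat \<Rightarrow> 'a \<Rightarrow> 'x) \<Rightarrow> (nat \<Rightarrow> 'a \<Rightarrow> 'u) \<Rightarrow> bool" where
  "resource_feasible D i r t x X U \<longleftrightarrow>
     local_feasible D i t x X U \<and>
     (\<forall>s\<in>{t..<horizon D}. AE \<omega> in prob D. coupling D s i (X s \<omega>) (U s \<omega>) = r s \<omega>)"

definition global_feasible ::
    "('a, 'i, 'x, 'u, 'w, 'r::real_vector, 'p) multi_unit \<Rightarrow> nat \<Rightarrow> ('i \<Rightarrow> 'x)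
      \<Rightarrow> ('i \<Rightarrow> nat \<Rightarrow> 'a \<Rightarrow> 'x) \<Rightarrow> ('i \<Rightarrow> nat \<Rightarrow> 'a \<Rightarrow> 'u) \<Rightarrow> bool" where
  "global_feasible D t x X U \<longleftrightarrow>
     (\<forall>i\<in>units D. local_feasible D i t (x i) (X i) (U i)) \<and>
     (\<forall>s\<in>{t..<horizon D}. AE \<omega> in prob D.
        (\<lambda>i\<in>units D. - coupling D s i (X i s \<omega>) (U i s \<omega>)) \<in> coupling_set D s)"

definition resource_cost ::
    "('a, 'i, 'x, 'u, 'w, 'r, 'p) multi_unit \<Rightarrow> 'i \<Rightarrow> nat
      \<Rightarrow> (nat \<Rightarrow> 'a \<Rightarrow> 'x) \<Rightarrow> (nat \<Rightarrow> 'a \<Rightarrow> 'u) \<Rightarrow> 'a \<Rightarrow> ereal" where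
  "resource_cost D i t X U \<omega> =
     (\<Sum>s=t..<horizon D. stage_cost D s i (X s \<omega>) (U s \<omega>) (noise D (Suc s) i \<omega>))
     + final_cost D i (X (horizon D) \<omega>)"

definition price_cost ::
    "('a, 'i, 'x, 'u, 'w, 'r, 'p) multi_unit \<Rightarrow> 'i \<Rightarrow> (nat \<Rightarrow> 'a \<Rightarrow> 'p) \<Rightarrow> nat
      \<Rightarrow> (nat \<Rightarrow> 'a \<Rightarrow> 'x) \<Rightarrow> (nat \<Rightarrow> 'a \<Rightarrow> 'u) \<Rightarrow> 'a \<Rightarrow> ereal" where
  "price_cost D i p t X U \<omega> =
     (\<Sum>s=t..<horizon D. stage_cost D s i (X s \<omega>) (U s \<omega>) (noise D (Suc s) i \<omega>)
        + ereal (pairing D s i (p s \<omega>) (coupling D s i (X s \<omega>) (U s \<omega>))))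
     + final_cost D i (X (horizon D) \<omega>)"

definition global_cost ::
    "('a, 'i, 'x, 'u, 'w, 'r, 'p) multi_unit \<Rightarrow> nat
      \<Rightarrow> ('i \<Rightarrow> nat \<Rightarrow> 'a \<Rightarrow> 'x) \<Rightarrow> ('i \<Rightarrow> nat \<Rightarrow> 'a \<Rightarrow> 'u) \<Rightarrow> 'a \<Rightarrow> ereal" where
  "global_cost D t X U \<omega> =
     (\<Sum>i\<in>units D. \<Sum>s=t..<horizon D.
        stage_cost D s i (X i s \<omega>) (U i s \<omega>) (noise D (Suc s) i \<omega>))
     + (\<Sum>i\<in>units D. final_cost D i (X i (horizon D) \<omega>))"

definition global_value ::
    "('a, 'i, 'x, 'u, 'w, 'r::real_vector, 'p) multi_unit \<Rightarrow> nat \<Rightarrow> ('i \<Rightarrow> 'x) \<Rightarrow> ereal" where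
  "global_value D t x =
     (if t = horizon D then (\<Sum>i\<in>units D. final_cost D i (x i))
      else Inf {ext_expectation (prob D) (global_cost D t X U) | X U. global_feasible D t x X U})"

definition price_value ::
    "('a, 'i, 'x, 'u, 'w, 'r, 'p) multi_unit \<Rightarrow> 'i \<Rightarrow> (nat \<Rightarrow> 'a \<Rightarrow> 'p) \<Rightarrow> nat \<Rightarrow> 'x \<Rightarrow> ereal" where
  "price_value D i p t x =
     (if t = horizon D then final_cost D i x
      else Inf {ext_expectation (prob D) (price_cost D i p t X U) | X U. local_feasible D i t x X U})"

definition resource_value ::
    "('a, 'i, 'x, 'u, 'w, 'r, 'p) multi_unit \<Rightarrow> 'i \<Rightarrow> (nat \<Rightarrow> 'a \<Rightarrow> 'r) \<Rightarrow> nat \<Rightarrow> 'x \<Rightarrow> ereal" where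
  "resource_value D i r t x =
     (if t = horizon D then final_cost D i x
      else Inf {ext_expectation (prob D) (resource_cost D i t X U) | X U. resource_feasible D i r t x X U})"

definition multi_unit_problem ::
    "('a, 'i, 'x, 'u, 'w, 'r::real_vector, 'p::real_vector) multi_unit \<Rightarrow> bool" where
  "multi_unit_problem D \<longleftrightarrow>
     finite (units D) \<and> horizon D \<ge> 1 \<and> prob_space (prob D) \<and>
     (\<forall>i\<in>units D. \<forall>t\<in>{1..horizon D}. noise D t i \<in> prob D \<rightarrow>\<^sub>M noise_space D t i) \<and>
     (\<forall>i\<in>units D. \<forall>t<horizon D.
        measurable_vector_space (resource_space D t i) \<and>
        measurable_vector_space (price_space D t i) \<and>
        bilinear_form_on (space (price_space D t i)) (space (resource_space D t i)) (pairing D t i) \<and>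
        (\<lambda>(x, u, w). dynamics D t i x u w)
          \<in> state_space D t i \<Otimes>\<^sub>M control_space D t i \<Otimes>\<^sub>M noise_space D (Suc t) i
             \<rightarrow>\<^sub>M state_space D (Suc t) i \<and>
        (\<lambda>(x, u). coupling D t i x u)
          \<in> state_space D t i \<Otimes>\<^sub>M control_space D t i \<rightarrow>\<^sub>M resource_space D t i \<and>
        (\<lambda>(x, u, w). stage_cost D t i x u w)
          \<in> state_space D t i \<Otimes>\<^sub>M control_space D t i \<Otimes>\<^sub>M noise_space D (Suc t) i \<rightarrow>\<^sub>M borel \<and>
        (\<forall>x\<in>space (state_space D t i). \<forall>u\<in>space (control_space D t i).
           \<forall>w\<in>space (noise_space D (Suc t) i). stage_cost D t i x u w \<noteq> - \<infinity>) \<and>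
        rv_vector_space (global_algebra D t) (resource_space D t i) (resource_rvs D t i) \<and>
        rv_vector_space (global_algebra D t) (price_space D t i) (price_rvs D t i)) \<and>
     (\<forall>i\<in>units D.
        final_cost D i \<in> state_space D (horizon D) i \<rightarrow>\<^sub>M borel \<and>
        (\<forall>x\<in>space (state_space D (horizon D) i). final_cost D i x \<noteq> - \<infinity>)) \<and>
     (\<forall>t<horizon D. coupling_set D t \<subseteq> (\<Pi>\<^sub>E i\<in>units D. space (resource_space D t i))) \<and>
     (\<forall>Z\<in>price_processes D. \<forall>Y\<in>resource_processes D. \<forall>t<horizon D.
        expectation_well_defined (prob D) (\<lambda>\<omega>. ereal (duality_product D Z Y t \<omega>))) \<and>
     (\<forall>i\<in>units D. \<forall>t<horizon D. \<forall>x\<in>space (state_space D t i). \<forall>X U.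
        local_feasible D i t x X U \<longrightarrow>
        (\<forall>s\<in>{t..<horizon D}. (\<lambda>\<omega>. coupling D s i (X s \<omega>) (U s \<omega>)) \<in> resource_rvs D s i))"

definition costs_well_defined ::
    "('a, 'i, 'x, 'u, 'w, 'r::real_vector, 'p) multi_unit
      \<Rightarrow> ('i \<Rightarrow> nat \<Rightarrow> 'a \<Rightarrow> 'p) \<Rightarrow> ('i \<Rightarrow> nat \<Rightarrow> 'a \<Rightarrow> 'r) \<Rightarrow> bool" where
  "costs_well_defined D P R \<longleftrightarrow>
     (\<forall>t<horizon D. \<forall>x\<in>(\<Pi>\<^sub>E i\<in>units D. space (state_space D t i)). \<forall>X U.
        global_feasible D t x X U \<longrightarrow>
        expectation_well_defined (prob D) (global_cost D t X U)) \<and>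
     (\<forall>i\<in>units D. \<forall>t<horizon D. \<forall>x\<in>space (state_space D t i). \<forall>X U.
        (local_feasible D i t x X U \<longrightarrow>
           expectation_well_defined (prob D) (price_cost D i (P i) t X U)) \<and>
        (resource_feasible D i (R i) t x X U \<longrightarrow>
           expectation_well_defined (prob D) (resource_cost D i t X U)))"

end

theory Submission
  imports Defs
begin

text \<open>
  Both inequalities compare the global problem with the sum of the local ones at fixed controls.

  For the lower bound, take a globally feasible pair of processes. Its components are feasible for
  the local price problems, and the sum of the local price costs is the global cost minus
  \<open>\<Sum>s. \<langle>P s, Y s\<rangle>\<close>, where \<open>Y = -\<Theta>\<close> on \<open>{t..<T}\<close>. The coupling
  constraint puts \<open>Y\<close> into the admissible set once it is completed by \<open>-R\<close> at the
  times before \<open>t\<close> (\<open>completed_coupling_admissible\<close>), so every duality product has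
  nonnegative expectation (\<open>duality_coupling_nonneg\<close>), and dropping them can only raise the cost. For the upper bound, locally feasible
  controls whose couplings equal the components of \<open>R\<close> fit together to a globally feasible
  control with the same total cost, so that the infima can be taken
  separately for each unit (\<open>le_sum_Inf\<close>).

  What needs care is additivity of the expectation, since costs may be infinite and expectations may
  take both infinite values. Additivity holds for functions whose negative part has finite integral
  (\<open>ext_expectation_sum\<close>). This is a consequence of the expectation being well defined and
  different from \<open>-\<infinity>\<close> (\<open>well_defined_imp_negative_part_finite\<close>). For the upper bound
  the value functions are greater than \<open>-\<infinity>\<close> by hypothesis; for the lower bound a unit
  with price value \<open>-\<infinity>\<close> makes the whole left-hand side \<open>-\<infinity>\<close>, as no other unit
  contributes \<open>\<infinity>\<close>.
\<close>

section \<open>Expectations of functions with finite negative part\<close>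

definition negative_part_finite :: "'a measure \<Rightarrow> ('a \<Rightarrow> ereal) \<Rightarrow> bool" where
  "negative_part_finite M f \<longleftrightarrow>
     f \<in> borel_measurable M \<and> (\<integral>\<^sup>+ \<omega>. e2ennreal (- f \<omega>) \<partial>M) < \<infinity>"

text \<open>
  If the negative part had infinite integral, the positive part would have a finite one, and the
  expectation would be \<open>-\<infinity>\<close>.
\<close>

lemma well_defined_imp_negative_part_finite:
  assumes "expectation_well_defined M f" and "ext_expectation M f > - \<infinity>"
  shows "negative_part_finite M f"
proof -
  have "(\<integral>\<^sup>+ \<omega>. e2ennreal (- f \<omega>) \<partial>M) < \<infinity>"
  proof (rule ccontr)
    assume "\<not> (\<integral>\<^sup>+ \<omega>. e2ennreal (- f \<omega>) \<partial>M) < \<infinity>"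
    then have neg: "(\<integral>\<^sup>+ \<omega>. e2ennreal (- f \<omega>) \<partial>M) = \<infinity>"
      by (simp add: less_top[symmetric])
    with assms(1) have "(\<integral>\<^sup>+ \<omega>. e2ennreal (f \<omega>) \<partial>M) < \<infinity>"
      by (simp add: expectation_well_defined_def)
    then have "enn2ereal (\<integral>\<^sup>+ \<omega>. e2ennreal (f \<omega>) \<partial>M) \<noteq> \<infinity>"
      by (cases "\<integral>\<^sup>+ \<omega>. e2ennreal (f \<omega>) \<partial>M") auto
    with neg have "ext_expectation M f = - \<infinity>"
      by (cases "enn2ereal (\<integral>\<^sup>+ \<omega>. e2ennreal (f \<omega>) \<partial>M)")
        (simp_all add: ext_expectation_def)
    with assms(2) show False by simp
  qed
  with assms(1) show ?thesis
    by (simp add: expectation_well_defined_def negative_part_finite_def)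
qed

text \<open>
  The identity \<open>(a + b)\<^sup>+ + a\<^sup>- + b\<^sup>- = (a + b)\<^sup>- + a\<^sup>+ + b\<^sup>+\<close> has no exceptions: when one of the
  arguments is infinite, both sides are \<open>\<infinity>\<close>, also for \<open>\<infinity> + (-\<infinity>) = \<infinity>\<close>.
\<close>

lemma positive_negative_parts_add:
  fixes a b :: ereal
  shows "e2ennreal (a + b) + e2ennreal (- a) + e2ennreal (- b) =
         e2ennreal (- (a + b)) + e2ennreal a + e2ennreal b"
proof (cases a; cases b)
  fix r s :: real
  assume "a = ereal r" "b = ereal s"
  moreover have "ennreal (r + s) + ennreal (- r) + ennreal (- s) =
      ennreal (- (r + s)) + ennreal r + ennreal s"
    by (cases "r \<ge> 0"; cases "s \<ge> 0"; cases "r + s \<ge> 0")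
      (auto simp: ennreal_neg simp flip: ennreal_plus)
  ultimately show ?thesis by simp
qed simp_all

lemma negative_part_add_le:
  fixes a b :: ereal
  shows "e2ennreal (- (a + b)) \<le> e2ennreal (- a) + e2ennreal (- b)"
proof (cases a; cases b)
  fix r s :: real
  assume "a = ereal r" "b = ereal s"
  moreover have "ennreal (- (r + s)) \<le> ennreal (- r) + ennreal (- s)"
    by (cases "r \<ge> 0"; cases "s \<ge> 0"; cases "r + s \<ge> 0")
      (auto simp: ennreal_neg ennreal_leI simp flip: ennreal_plus)
  ultimately show ?thesis by simp
qed simp_all

lemma negative_part_finite_add:
  assumes "negative_part_finite M f" and "negative_part_finite M g"
  shows "negative_part_finite M (\<lambda>\<omega>. f \<omega> + g \<omega>)"
proof -
  have [measurable]: "f \<in> borel_measurable M" "g \<in> borel_measurable M"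
    using assms by (simp_all add: negative_part_finite_def)
  have "(\<integral>\<^sup>+ \<omega>. e2ennreal (- (f \<omega> + g \<omega>)) \<partial>M)
      \<le> (\<integral>\<^sup>+ \<omega>. e2ennreal (- f \<omega>) + e2ennreal (- g \<omega>) \<partial>M)"
    by (intro nn_integral_mono negative_part_add_le)
  also have "\<dots> = (\<integral>\<^sup>+ \<omega>. e2ennreal (- f \<omega>) \<partial>M) + (\<integral>\<^sup>+ \<omega>. e2ennreal (- g \<omega>) \<partial>M)"
    by (intro nn_integral_add) measurable
  also have "\<dots> < \<infinity>"
    using assms by (simp add: negative_part_finite_def)
  finally show ?thesis by (simp add: negative_part_finite_def)
qed

text \<open>
  Integrating \<open>positive_negative_parts_add\<close> gives an identity between extended nonnegative
  integrals, in which the three integrals of negative parts are finite and can be subtracted.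
\<close>

lemma ext_expectation_add:
  assumes "negative_part_finite M f" and "negative_part_finite M g"
  shows "ext_expectation M (\<lambda>\<omega>. f \<omega> + g \<omega>) = ext_expectation M f + ext_expectation M g"
proof -
  have [measurable]: "f \<in> borel_measurable M" "g \<in> borel_measurable M"
    using assms by (simp_all add: negative_part_finite_def)
  define pos where "pos h = (\<integral>\<^sup>+ \<omega>. e2ennreal (h \<omega>) \<partial>M)" for h :: "'a \<Rightarrow> ereal"
  define neg where "neg h = (\<integral>\<^sup>+ \<omega>. e2ennreal (- h \<omega>) \<partial>M)" for h :: "'a \<Rightarrow> ereal"
  have expectation_eq: "ext_expectation M h = enn2ereal (pos h) - enn2ereal (neg h)" for h
    by (simp add: ext_expectation_def pos_def neg_def)
  let ?h = "\<lambda>\<omega>. f \<omega> + g \<omega>"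
  have "pos ?h + neg f + neg g =
      (\<integral>\<^sup>+ \<omega>. e2ennreal (?h \<omega>) + e2ennreal (- f \<omega>) + e2ennreal (- g \<omega>) \<partial>M)"
    unfolding pos_def neg_def by (simp add: nn_integral_add)
  also have "\<dots> = (\<integral>\<^sup>+ \<omega>. e2ennreal (- ?h \<omega>) + e2ennreal (f \<omega>) + e2ennreal (g \<omega>) \<partial>M)"
    by (simp only: positive_negative_parts_add)
  also have "\<dots> = neg ?h + pos f + pos g"
    unfolding pos_def neg_def by (simp add: nn_integral_add)
  finally have balance: "pos ?h + neg f + neg g = neg ?h + pos f + pos g" .
  have "neg ?h < \<infinity>" "neg f < \<infinity>" "neg g < \<infinity>"
    using assms negative_part_finite_add[OF assms]
    by (simp_all add: negative_part_finite_def neg_def)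
  then obtain a b c where abc: "a \<ge> 0" "neg ?h = ennreal a" "b \<ge> 0" "neg f = ennreal b"
      "c \<ge> 0" "neg g = ennreal c"
    by (metis ennreal_cases infinity_ennreal_def order_less_irrefl)
  have "enn2ereal (pos ?h) + ereal b + ereal c = ereal a + enn2ereal (pos f) + enn2ereal (pos g)"
    using arg_cong[OF balance, of enn2ereal] abc by (simp add: plus_ennreal.rep_eq)
  then have "enn2ereal (pos ?h) - ereal a =
      (enn2ereal (pos f) - ereal b) + (enn2ereal (pos g) - ereal c)"
    by (cases "enn2ereal (pos ?h)"; cases "enn2ereal (pos f)"; cases "enn2ereal (pos g)") auto
  then show ?thesis
    using abc by (simp add: expectation_eq)
qed

lemma negative_part_finite_zero: "negative_part_finite M (\<lambda>\<omega>. 0)"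
  by (simp add: negative_part_finite_def)

lemma negative_part_finite_sum:
  assumes "\<And>i. i \<in> I \<Longrightarrow> negative_part_finite M (f i)"
  shows "negative_part_finite M (\<lambda>\<omega>. \<Sum>i\<in>I. f i \<omega>)"
  using assms
  by (induction I rule: infinite_finite_induct)
    (simp_all add: negative_part_finite_zero negative_part_finite_add)

lemma ext_expectation_sum:
  assumes "\<And>i. i \<in> I \<Longrightarrow> negative_part_finite M (f i)"
  shows "ext_expectation M (\<lambda>\<omega>. \<Sum>i\<in>I. f i \<omega>) = (\<Sum>i\<in>I. ext_expectation M (f i))"
  using assms
  by (induction I rule: infinite_finite_induct)
    (simp_all add: ext_expectation_def[of M "\<lambda>\<omega>. 0"] ext_expectation_add negative_part_finite_sum)

lemma ext_expectation_cong:
  assumes "\<And>\<omega>. \<omega> \<in> space M \<Longrightarrow> f \<omega> = g \<omega>"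
  shows "ext_expectation M f = ext_expectation M g"
  unfolding ext_expectation_def using assms by (simp cong: nn_integral_cong)

lemma expectation_well_defined_cong:
  assumes "\<And>\<omega>. \<omega> \<in> space M \<Longrightarrow> f \<omega> = g \<omega>"
  shows "expectation_well_defined M f \<longleftrightarrow> expectation_well_defined M g"
proof -
  have "f \<in> borel_measurable M \<longleftrightarrow> g \<in> borel_measurable M"
    using assms by (rule measurable_cong)
  moreover have "(\<integral>\<^sup>+ \<omega>. e2ennreal (f \<omega>) \<partial>M) = (\<integral>\<^sup>+ \<omega>. e2ennreal (g \<omega>) \<partial>M)"
    "(\<integral>\<^sup>+ \<omega>. e2ennreal (- f \<omega>) \<partial>M) = (\<integral>\<^sup>+ \<omega>. e2ennreal (- g \<omega>) \<partial>M)"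
    using assms by (simp_all cong: nn_integral_cong)
  ultimately show ?thesis by (simp add: expectation_well_defined_def)
qed

section \<open>Separate minimisation\<close>

text \<open>
  An infimum \<open>\<infinity>\<close> makes the right-hand side \<open>\<infinity>\<close>. Otherwise all infima are real, and
  near-minimal elements chosen independently in each set have a sum near the sum of the infima.
\<close>

lemma le_sum_Inf:
  fixes A :: "'i \<Rightarrow> ereal set"
  assumes "finite I"
    and bounded: "\<And>i. i \<in> I \<Longrightarrow> Inf (A i) > - \<infinity>"
    and le: "\<And>c. (\<And>i. i \<in> I \<Longrightarrow> c i \<in> A i) \<Longrightarrow> y \<le> (\<Sum>i\<in>I. c i)"
  shows "y \<le> (\<Sum>i\<in>I. Inf (A i))"
proof (cases "\<exists>i\<in>I. Inf (A i) = \<infinity>")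
  case True
  with \<open>finite I\<close> have "(\<Sum>i\<in>I. Inf (A i)) = \<infinity>"
    by (simp add: sum_Pinfty)
  then show ?thesis by simp
next
  case False
  show ?thesis
  proof (rule ereal_le_epsilon2)
    show "y \<le> (\<Sum>i\<in>I. Inf (A i)) + ereal e" if "e > 0" for e :: real
    proof -
      \<comment> \<open>the denominator \<open>card I + 1\<close> covers the empty index set\<close>
      define \<delta> where "\<delta> = e / (card I + 1)"
      have "\<delta> > 0" using \<open>e > 0\<close> by (simp add: \<delta>_def)
      have "card I * \<delta> \<le> e" using \<open>e > 0\<close> by (simp add: \<delta>_def field_simps)
      have "\<exists>c\<in>A i. c < Inf (A i) + ereal \<delta>" if "i \<in> I" for i
      proof -
        have "Inf (A i) < Inf (A i) + ereal \<delta>"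
          using bounded[OF that] False that \<open>\<delta> > 0\<close> by (cases "Inf (A i)") auto
        then show ?thesis by (simp add: Inf_less_iff)
      qed
      then obtain c where c: "\<And>i. i \<in> I \<Longrightarrow> c i \<in> A i \<and> c i < Inf (A i) + ereal \<delta>"
        by metis
      have "y \<le> (\<Sum>i\<in>I. c i)" using c by (intro le) simp
      also have "\<dots> \<le> (\<Sum>i\<in>I. Inf (A i) + ereal \<delta>)"
        using c by (intro sum_mono) (simp add: less_imp_le)
      also have "\<dots> = (\<Sum>i\<in>I. Inf (A i)) + ereal (card I * \<delta>)"
        by (simp add: sum.distrib)
      also have "\<dots> \<le> (\<Sum>i\<in>I. Inf (A i)) + ereal e"
        using \<open>card I * \<delta> \<le> e\<close> by (intro add_left_mono) simp
      finally show ?thesis .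
    qed
  qed
qed

section \<open>Decomposition of the global problem\<close>

lemma global_cost_eq_sum_resource_cost:
  "global_cost D t X U \<omega> = (\<Sum>i\<in>units D. resource_cost D i t (X i) (U i) \<omega>)"
  by (simp add: global_cost_def resource_cost_def sum.distrib)

lemma price_cost_eq_resource_cost:
  "price_cost D i p t X U \<omega> = resource_cost D i t X U \<omega>
     + ereal (\<Sum>s=t..<horizon D. pairing D s i (p s \<omega>) (coupling D s i (X s \<omega>) (U s \<omega>)))"
  by (simp add: price_cost_def resource_cost_def sum.distrib ac_simps)

lemma pairing_uminus_right:
  assumes "bilinear_form_on A B b" and "p \<in> A" and "r \<in> B"
  shows "b p (- r) = - b p r"
proof -
  have "b p ((- 1) *\<^sub>R r) = - 1 * b p r"
    using assms unfolding bilinear_form_on_def by blast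
  then show ?thesis by simp
qed

lemma space_global_algebra: "space (global_algebra D t) = space (prob D)"
  by (simp add: global_algebra_def noise_algebra_def space_measure_of_conv)

lemma rv_vector_space_uminus:
  assumes "rv_vector_space F V L" and "Y \<in> L"
  shows "(\<lambda>\<omega>. - Y \<omega>) \<in> L"
proof -
  have "(\<lambda>\<omega>. (- 1) *\<^sub>R Y \<omega>) \<in> L"
    using assms unfolding rv_vector_space_def by blast
  then show ?thesis by simp
qed

text \<open>
  Prices are tested against processes on the whole horizon, whereas a feasible solution starting at
  time \<open>t\<close> only determines the couplings from \<open>t\<close> on. Any admissible process may be used
  before \<open>t\<close>; the process \<open>-R\<close> given by an admissible resource is one.
\<close>

lemma completed_coupling_admissible:
  assumes problem: "multi_unit_problem D"
    and R: "R \<in> admissible_resources D"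
    and x: "\<And>i. i \<in> units D \<Longrightarrow> x i \<in> space (state_space D t i)"
    and feas: "global_feasible D t x X U"
  shows "(\<lambda>i s \<omega>. if s < t then - R i s \<omega> else - coupling D s i (X i s \<omega>) (U i s \<omega>))
           \<in> admissible_set D"
    (is "?Y \<in> _")
proof -
  have R': "\<And>i s. i \<in> units D \<Longrightarrow> s < horizon D \<Longrightarrow> (\<lambda>\<omega>. - R i s \<omega>) \<in> resource_rvs D s i"
    "\<And>s. s < horizon D \<Longrightarrow> AE \<omega> in prob D. (\<lambda>i\<in>units D. - R i s \<omega>) \<in> coupling_set D s"
    using R by (auto simp: admissible_resources_def admissible_set_def resource_processes_def)
  have mem: "?Y i s \<in> resource_rvs D s i" if "i \<in> units D" "s < horizon D" for i s
  proof (cases "s < t")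
    case True
    then show ?thesis using R'(1)[OF that] by simp
  next
    case False
    then have "t < horizon D" "s \<in> {t..<horizon D}" using that by auto
    moreover have "local_feasible D i t (x i) (X i) (U i)"
      using feas that by (simp add: global_feasible_def)
    ultimately have "(\<lambda>\<omega>. coupling D s i (X i s \<omega>) (U i s \<omega>)) \<in> resource_rvs D s i"
      using problem that x unfolding multi_unit_problem_def by blast
    moreover have "rv_vector_space (global_algebra D s) (resource_space D s i) (resource_rvs D s i)"
      using problem that unfolding multi_unit_problem_def by blast
    ultimately show ?thesis using False rv_vector_space_uminus by auto
  qed
  have "AE \<omega> in prob D. (\<lambda>i\<in>units D. ?Y i s \<omega>) \<in> coupling_set D s" if "s < horizon D" for s
    using R'(2)[OF that] feas that by (cases "s < t") (auto simp: global_feasible_def)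
  with mem show ?thesis by (simp add: admissible_set_def resource_processes_def)
qed

text \<open>
  The sign matters for the second claim: as the expectation is well defined, being nonnegative
  rules out an infinite negative part, whereas the positive part may be infinite.
\<close>

lemma duality_coupling_nonneg:
  assumes problem: "multi_unit_problem D"
    and P: "P \<in> admissible_prices D"
    and R: "R \<in> admissible_resources D"
    and x: "\<And>i. i \<in> units D \<Longrightarrow> x i \<in> space (state_space D t i)"
    and feas: "global_feasible D t x X U"
    and s: "s \<in> {t..<horizon D}"
  defines "d \<equiv> \<lambda>\<omega>. ereal (- (\<Sum>i\<in>units D. pairing D s i (P i s \<omega>)
                                  (coupling D s i (X i s \<omega>) (U i s \<omega>))))"
  shows "ext_expectation (prob D) d \<ge> 0" and "negative_part_finite (prob D) d"
proof -
  define Y where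
    "Y i s \<omega> = (if s < t then - R i s \<omega> else - coupling D s i (X i s \<omega>) (U i s \<omega>))" for i s \<omega>
  have Y: "Y \<in> admissible_set D"
    using completed_coupling_admissible[OF problem R x feas] unfolding Y_def .
  have pairing_Y: "pairing D s i (P i s \<omega>) (Y i s \<omega>) =
      - pairing D s i (P i s \<omega>) (coupling D s i (X i s \<omega>) (U i s \<omega>))"
    if i: "i \<in> units D" and \<omega>: "\<omega> \<in> space (prob D)" for i \<omega>
  proof -
    have sT: "s < horizon D" "t < horizon D" and st: "\<not> s < t" using s by auto
    have "P i s \<in> price_rvs D s i"
      using P i sT by (simp add: admissible_prices_def price_processes_def)
    moreover have "rv_vector_space (global_algebra D s) (price_space D s i) (price_rvs D s i)"
      using problem i sT unfolding multi_unit_problem_def by blast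
    ultimately have P_meas: "P i s \<in> global_algebra D s \<rightarrow>\<^sub>M price_space D s i"
      unfolding rv_vector_space_def by blast
    have p: "P i s \<omega> \<in> space (price_space D s i)"
      using \<omega> measurable_space[OF P_meas] by (simp add: space_global_algebra)
    have "local_feasible D i t (x i) (X i) (U i)"
      using feas i by (simp add: global_feasible_def)
    then have "(\<lambda>\<omega>. coupling D s i (X i s \<omega>) (U i s \<omega>)) \<in> resource_rvs D s i"
      using problem i s sT x unfolding multi_unit_problem_def by blast
    moreover have "rv_vector_space (global_algebra D s) (resource_space D s i) (resource_rvs D s i)"
      using problem i sT unfolding multi_unit_problem_def by blast
    ultimately have coupling_meas: "(\<lambda>\<omega>. coupling D s i (X i s \<omega>) (U i s \<omega>))
        \<in> global_algebra D s \<rightarrow>\<^sub>M resource_space D s i"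
      unfolding rv_vector_space_def by blast
    have r: "coupling D s i (X i s \<omega>) (U i s \<omega>) \<in> space (resource_space D s i)"
      using \<omega> measurable_space[OF coupling_meas] by (simp add: space_global_algebra)
    have "bilinear_form_on (space (price_space D s i)) (space (resource_space D s i))
        (pairing D s i)"
      using problem i sT unfolding multi_unit_problem_def by blast
    from pairing_uminus_right[OF this p r] show ?thesis using st by (simp add: Y_def)
  qed
  have d_eq: "d \<omega> = ereal (duality_product D P Y s \<omega>)" if "\<omega> \<in> space (prob D)" for \<omega>
    using pairing_Y that by (simp add: d_def duality_product_def sum_negf)
  have "ext_expectation (prob D) (\<lambda>\<omega>. ereal (duality_product D P Y s \<omega>)) \<ge> 0"
    using P Y s by (simp add: admissible_prices_def)
  then show nonneg: "ext_expectation (prob D) d \<ge> 0"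
    using ext_expectation_cong[of "prob D" d] d_eq by simp
  have "P \<in> price_processes D" "Y \<in> resource_processes D"
    using P Y by (auto simp: admissible_prices_def admissible_set_def)
  then have "expectation_well_defined (prob D) (\<lambda>\<omega>. ereal (duality_product D P Y s \<omega>))"
    using problem s unfolding multi_unit_problem_def by simp
  then have "expectation_well_defined (prob D) d"
    using expectation_well_defined_cong[of "prob D" d] d_eq by simp
  then show "negative_part_finite (prob D) d"
    using nonneg by (intro well_defined_imp_negative_part_finite) auto
qed

section \<open>The two bounds\<close>

text \<open>
  The global cost is the sum of the price costs plus the duality products. All these terms
  have negative parts with finite integral, so the expectation is additive even where a duality
  product has expectation \<open>\<infinity>\<close>. If some price value is \<open>-\<infinity>\<close>, the price cost of that unit
  may have an infinite negative part; the bound is then trivial because the other price values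
  are less than \<open>\<infinity>\<close>.
\<close>

lemma sum_price_value_le_global_cost:
  assumes problem: "multi_unit_problem D"
    and P: "P \<in> admissible_prices D"
    and R: "R \<in> admissible_resources D"
    and wd: "costs_well_defined D P R"
    and t: "t < horizon D"
    and x: "\<And>i. i \<in> units D \<Longrightarrow> x i \<in> space (state_space D t i)"
    and finite_value: "\<And>i. i \<in> units D \<Longrightarrow> price_value D i (P i) t (x i) < \<infinity>"
    and feas: "global_feasible D t x X U"
  shows "(\<Sum>i\<in>units D. price_value D i (P i) t (x i)) \<le> ext_expectation (prob D) (global_cost D t X U)"
proof (cases "\<exists>j\<in>units D. price_value D j (P j) t (x j) = - \<infinity>")
  case True
  then obtain j where j: "j \<in> units D" "price_value D j (P j) t (x j) = - \<infinity>" by blast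
  have fin: "finite (units D)" using problem by (simp add: multi_unit_problem_def)
  have "(\<Sum>i\<in>units D - {j}. price_value D i (P i) t (x i)) \<noteq> \<infinity>"
    using finite_value by (auto simp: sum_Pinfty)
  then have "(\<Sum>i\<in>units D. price_value D i (P i) t (x i)) = - \<infinity>"
    using j fin by (cases "\<Sum>i\<in>units D - {j}. price_value D i (P i) t (x i)")
      (simp_all add: sum.remove)
  then show ?thesis by simp
next
  case False
  let ?C = "\<lambda>i. price_cost D i (P i) t (X i) (U i)"
  define d where "d s \<omega> = ereal (- (\<Sum>i\<in>units D. pairing D s i (P i s \<omega>)
      (coupling D s i (X i s \<omega>) (U i s \<omega>))))" for s \<omega>
  have loc: "local_feasible D i t (x i) (X i) (U i)" if "i \<in> units D" for i
    using feas that by (simp add: global_feasible_def)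
  have ge: "price_value D i (P i) t (x i) \<le> ext_expectation (prob D) (?C i)"
    if "i \<in> units D" for i
    using t loc[OF that] by (auto simp: price_value_def intro!: Inf_lower)
  have C: "negative_part_finite (prob D) (?C i)" if i: "i \<in> units D" for i
  proof (rule well_defined_imp_negative_part_finite)
    show "expectation_well_defined (prob D) (?C i)"
      using wd t x[OF i] i loc[OF i] unfolding costs_well_defined_def by blast
    show "ext_expectation (prob D) (?C i) > - \<infinity>"
      using False i by (intro less_le_trans[OF _ ge[OF i]]) auto
  qed
  have d: "ext_expectation (prob D) (d s) \<ge> 0" "negative_part_finite (prob D) (d s)"
    if "s \<in> {t..<horizon D}" for s
    using duality_coupling_nonneg[OF problem P R x feas that]
    by (simp_all add: d_def[abs_def])
  have cost: "global_cost D t X U = (\<lambda>\<omega>. (\<Sum>i\<in>units D. ?C i \<omega>) + (\<Sum>s=t..<horizon D. d s \<omega>))"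
  proof
    fix \<omega>
    let ?q = "\<Sum>i\<in>units D. \<Sum>s=t..<horizon D.
      pairing D s i (P i s \<omega>) (coupling D s i (X i s \<omega>) (U i s \<omega>))"
    have "(\<Sum>s=t..<horizon D. d s \<omega>) = ereal (- ?q)"
      by (simp add: d_def sum_negf sum.swap[of _ "units D"])
    moreover have "(\<Sum>i\<in>units D. ?C i \<omega>) = global_cost D t X U \<omega> + ereal ?q"
      by (simp add: price_cost_eq_resource_cost global_cost_eq_sum_resource_cost sum.distrib)
    ultimately show "global_cost D t X U \<omega> = (\<Sum>i\<in>units D. ?C i \<omega>) + (\<Sum>s=t..<horizon D. d s \<omega>)"
      by (cases "global_cost D t X U \<omega>") simp_all
  qed
  have "(\<Sum>i\<in>units D. price_value D i (P i) t (x i))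
      \<le> (\<Sum>i\<in>units D. ext_expectation (prob D) (?C i)) + 0"
    using ge by (simp add: sum_mono)
  also have "\<dots> \<le> (\<Sum>i\<in>units D. ext_expectation (prob D) (?C i))
      + (\<Sum>s=t..<horizon D. ext_expectation (prob D) (d s))"
    using d by (intro add_left_mono sum_nonneg) auto
  also have "\<dots> = ext_expectation (prob D) (global_cost D t X U)"
  proof -
    have "negative_part_finite (prob D) (\<lambda>\<omega>. \<Sum>i\<in>units D. ?C i \<omega>)"
      by (intro negative_part_finite_sum C)
    moreover have "negative_part_finite (prob D) (\<lambda>\<omega>. \<Sum>s=t..<horizon D. d s \<omega>)"
      by (intro negative_part_finite_sum d)
    ultimately have "ext_expectation (prob D) (global_cost D t X U) =
        ext_expectation (prob D) (\<lambda>\<omega>. \<Sum>i\<in>units D. ?C i \<omega>)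
        + ext_expectation (prob D) (\<lambda>\<omega>. \<Sum>s=t..<horizon D. d s \<omega>)"
      unfolding cost by (rule ext_expectation_add)
    then show ?thesis
      using C d by (simp only: ext_expectation_sum)
  qed
  finally show ?thesis .
qed

lemma global_feasible_if_resource_feasible:
  assumes "finite (units D)"
    and R: "R \<in> admissible_resources D"
    and feas: "\<And>i. i \<in> units D \<Longrightarrow> resource_feasible D i (R i) t (x i) (X i) (U i)"
  shows "global_feasible D t x X U"
  unfolding global_feasible_def
proof (intro conjI ballI)
  show "local_feasible D i t (x i) (X i) (U i)" if "i \<in> units D" for i
    using feas[OF that] by (simp add: resource_feasible_def)
  show "AE \<omega> in prob D. (\<lambda>i\<in>units D. - coupling D s i (X i s \<omega>) (U i s \<omega>)) \<in> coupling_set D s"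
    if s: "s \<in> {t..<horizon D}" for s
  proof -
    have "AE \<omega> in prob D. \<forall>i\<in>units D. coupling D s i (X i s \<omega>) (U i s \<omega>) = R i s \<omega>"
      using feas s by (intro AE_finite_allI assms(1)) (simp add: resource_feasible_def)
    moreover have "AE \<omega> in prob D. (\<lambda>i\<in>units D. - R i s \<omega>) \<in> coupling_set D s"
      using R s by (simp add: admissible_resources_def admissible_set_def)
    ultimately show ?thesis
    proof eventually_elim
      case (elim \<omega>)
      then have "(\<lambda>i\<in>units D. - coupling D s i (X i s \<omega>) (U i s \<omega>)) = (\<lambda>i\<in>units D. - R i s \<omega>)"
        by (intro restrict_ext) simp
      with elim show ?case by simp
    qed
  qed
qed

lemma global_value_le_sum_resource_value:
  assumes problem: "multi_unit_problem D"
    and R: "R \<in> admissible_resources D"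
    and wd: "costs_well_defined D P R"
    and t: "t < horizon D"
    and x: "\<And>i. i \<in> units D \<Longrightarrow> x i \<in> space (state_space D t i)"
    and value_gt: "\<And>i. i \<in> units D \<Longrightarrow> resource_value D i (R i) t (x i) > - \<infinity>"
  shows "global_value D t x \<le> (\<Sum>i\<in>units D. resource_value D i (R i) t (x i))"
proof -
  have fin: "finite (units D)" using problem by (simp add: multi_unit_problem_def)
  define A where "A i = {ext_expectation (prob D) (resource_cost D i t X U) | X U.
      resource_feasible D i (R i) t (x i) X U}" for i
  have value_eq: "resource_value D i (R i) t (x i) = Inf (A i)" for i
    using t by (simp add: resource_value_def A_def)
  have "global_value D t x \<le> (\<Sum>i\<in>units D. Inf (A i))"
  proof (rule le_sum_Inf[OF fin])
    show "Inf (A i) > - \<infinity>" if "i \<in> units D" for i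
      using value_gt[OF that] by (simp add: value_eq)
    fix c
    assume c: "\<And>i. i \<in> units D \<Longrightarrow> c i \<in> A i"
    have "\<exists>XU. c i = ext_expectation (prob D) (resource_cost D i t (fst XU) (snd XU)) \<and>
        resource_feasible D i (R i) t (x i) (fst XU) (snd XU)" if "i \<in> units D" for i
      using c[OF that] by (auto simp: A_def)
    then obtain XU where XU: "\<And>i. i \<in> units D \<Longrightarrow>
        c i = ext_expectation (prob D) (resource_cost D i t (fst (XU i)) (snd (XU i))) \<and>
        resource_feasible D i (R i) t (x i) (fst (XU i)) (snd (XU i))"
      by metis
    define X U where "X i = fst (XU i)" and "U i = snd (XU i)" for i
    have feas: "resource_feasible D i (R i) t (x i) (X i) (U i)"
      and c_eq: "c i = ext_expectation (prob D) (resource_cost D i t (X i) (U i))"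
      if "i \<in> units D" for i
      using XU[OF that] by (simp_all add: X_def U_def)
    have finite_neg: "negative_part_finite (prob D) (resource_cost D i t (X i) (U i))"
      if i: "i \<in> units D" for i
    proof (rule well_defined_imp_negative_part_finite)
      show "expectation_well_defined (prob D) (resource_cost D i t (X i) (U i))"
        using wd t x[OF i] i feas[OF i] unfolding costs_well_defined_def by blast
      have "Inf (A i) \<le> c i" using c[OF i] by (rule Inf_lower)
      with value_gt[OF i] have "- \<infinity> < c i"
        unfolding value_eq by (rule less_le_trans)
      then show "ext_expectation (prob D) (resource_cost D i t (X i) (U i)) > - \<infinity>"
        by (simp only: c_eq[OF i])
    qed
    have "global_value D t x \<le> ext_expectation (prob D) (global_cost D t X U)"
      using t global_feasible_if_resource_feasible[where x = x, OF fin R feas]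
      by (auto simp: global_value_def intro!: Inf_lower)
    also have "\<dots> = (\<Sum>i\<in>units D. ext_expectation (prob D) (resource_cost D i t (X i) (U i)))"
      using ext_expectation_sum[OF finite_neg]
      by (simp add: global_cost_eq_sum_resource_cost[abs_def])
    also have "\<dots> = (\<Sum>i\<in>units D. c i)" by (simp add: c_eq)
    finally show "global_value D t x \<le> (\<Sum>i\<in>units D. c i)" .
  qed
  then show ?thesis by (simp add: value_eq)
qed

theorem proposition2:
  fixes D :: "('a, 'i, 'x, 'u, 'w, 'r::real_vector, 'p::real_vector) multi_unit"
    and P :: "'i \<Rightarrow> nat \<Rightarrow> 'a \<Rightarrow> 'p"
    and R :: "'i \<Rightarrow> nat \<Rightarrow> 'a \<Rightarrow> 'r"
  assumes "multi_unit_problem D"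
    and "P \<in> admissible_prices D"
    and "R \<in> admissible_resources D"
    and "costs_well_defined D P R"
    and "\<forall>i\<in>units D. \<forall>t\<in>{0..horizon D}. \<forall>x\<in>space (state_space D t i).
           price_value D i (P i) t x < \<infinity>"
    and "\<forall>i\<in>units D. \<forall>t\<in>{0..horizon D}. \<forall>x\<in>space (state_space D t i).
           resource_value D i (R i) t x > - \<infinity>"
  shows "\<forall>t\<in>{0..horizon D}. \<forall>x\<in>(\<Pi>\<^sub>E i\<in>units D. space (state_space D t i)).
           (\<Sum>i\<in>units D. price_value D i (P i) t (x i)) \<le> global_value D t x \<and>
           global_value D t x \<le> (\<Sum>i\<in>units D. resource_value D i (R i) t (x i))"
proof (intro ballI)
  fix t x
  assume t: "t \<in> {0..horizon D}" and "x \<in> (\<Pi>\<^sub>E i\<in>units D. space (state_space D t i))"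
  then have x: "\<And>i. i \<in> units D \<Longrightarrow> x i \<in> space (state_space D t i)" by auto
  show "(\<Sum>i\<in>units D. price_value D i (P i) t (x i)) \<le> global_value D t x \<and>
      global_value D t x \<le> (\<Sum>i\<in>units D. resource_value D i (R i) t (x i))"
  proof (cases "t = horizon D")
    case True
    then show ?thesis by (simp add: price_value_def resource_value_def global_value_def)
  next
    case False
    with t have t': "t < horizon D" by simp
    have "(\<Sum>i\<in>units D. price_value D i (P i) t (x i)) \<le> global_value D t x"
      using sum_price_value_le_global_cost[OF assms(1-4) t', of x] assms(5) t x False
      by (auto simp: global_value_def intro!: Inf_greatest)
    moreover have "global_value D t x \<le> (\<Sum>i\<in>units D. resource_value D i (R i) t (x i))"
      using assms(6) t x by (intro global_value_le_sum_resource_value[OF assms(1,3,4) t']) auto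
    ultimately show ?thesis ..
  qed
qed

end
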